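(* Let $G$ be a graph, $\mathcal{H}$ a family of connected subgraphs of $G$, and $\ell,d\in\mathbb{N}$. Suppose $(T,\beta,\gamma)$ is a guarded tree-decomposition of $G$ of vigilance $\ell$ that distance-$d$ guards $\mathcal{H}$. Then for every $k\in\mathbb{N}$, there exists one of the following: a subfamily $\mathcal{H}'\subseteq\mathcal{H}$ of size $k$ that is $d$-scattered in $G$; or a set $X\subseteq V(G)$ with $|X|\leq \ell(k-1)$ such that $\mathsf{Ball}^d_G(X)$ intersects every member of $\mathcal{H}$.
   Context: $\mathsf{Ball}^d_G(X)$ is the set of vertices at distance at most $d$ in $G$ from some vertex of $X$. A family of subgraphs is $d$-scattered in $G$ if every two distinct members $H,H'$ satisfy $\min\{\mathsf{dist}_G(u,u')\colon u\in V(H),u'\in V(H')\}>d$. A rooted tree-decomposition $(T,\beta)$ consists of a rooted tree $T$ and bags $\beta(t)\subseteq V(G)$ such that every edge of $G$ lies in some bag and for each vertex the nodes whose bags contain it induce a non-empty connected subtree. A guarded tree-decomposition is a triple $(T,\beta,\gamma)$ with $(T,\beta)$ a rooted tree-decomposition, $\gamma(t)\subseteq\beta(t)$ for every node $t$, and $\gamma(t)\supseteq\beta(t)\cap\beta(t')$ whenever $t'$ is the parent of $t$. Its vigilance is $\max_t|\gamma(t)|$. It distance-$d$ guards $\mathcal{H}$ if for every $H\in\mathcal{H}$ and node $t$, if $H$ intersects $\beta(t)$ then $H$ intersects $\mathsf{Ball}^d_G(\gamma(t))$. *)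

theory Defs
  imports "Graph_Theory.Graph_Theory"
begin

text \<open>
  Undirected graphs are symmetric digraphs without loops and parallel arcs, an edge being a pair of
  opposite arcs. Unlike the locale \<^locale>\<open>graph\<close>, this one does not require finiteness.
\<close>

locale simple_graph = sym_digraph + loopfree_digraph + nomulti_digraph

text \<open>\<^const>\<open>connected\<close> excludes the null graph, so members of such a family are non-empty.\<close>

definition connected_subgraphs :: "('a,'b) pre_digraph \<Rightarrow> ('a,'b) pre_digraph set" where
  "connected_subgraphs G = {H. subgraph H G \<and> symmetric H \<and> connected H}"

definition gdist :: "('a,'b) pre_digraph \<Rightarrow> 'a \<Rightarrow> 'a \<Rightarrow> ereal" where
  "gdist G u v = wf_digraph.\<mu> G (\<lambda>_. 1) u v"

definition graph_ball :: "('a,'b) pre_digraph \<Rightarrow> nat \<Rightarrow> 'a set \<Rightarrow> 'a set" where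
  "graph_ball G d X = {v \<in> verts G. \<exists>x\<in>X. gdist G x v \<le> ereal (real d)}"

text \<open>Distances lie in the naturals extended by infinity, so the infimum below is the minimum.\<close>

definition scattered :: "('a,'b) pre_digraph \<Rightarrow> nat \<Rightarrow> ('a,'b) pre_digraph set \<Rightarrow> bool" where
  "scattered G d \<H> \<longleftrightarrow> (\<forall>H\<in>\<H>. \<forall>H'\<in>\<H>. H \<noteq> H' \<longrightarrow>
     (INF (u, u') \<in> verts H \<times> verts H'. gdist G u u') > ereal (real d))"

text \<open>
  The library predicate \<^const>\<open>tree\<close> cannot be used: in a symmetric digraph, an arc followed by its
  reverse is already a \<^const>\<open>pre_digraph.cycle\<close>. The cycles of the undirected graph are those of
  length at least 3. The locale \<^locale>\<open>graph\<close> makes the tree finite.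
\<close>

definition rooted_tree :: "('t,'e) pre_digraph \<Rightarrow> 't \<Rightarrow> bool" where
  "rooted_tree T r \<longleftrightarrow> graph T \<and> connected T \<and>
     \<not> (\<exists>p. pre_digraph.cycle T p \<and> length p \<ge> 3) \<and> r \<in> verts T"

text \<open>\<open>t'\<close> is the parent of \<open>t\<close> if it precedes \<open>t\<close> on the path from the root to \<open>t\<close>.\<close>

definition parent :: "('t,'e) pre_digraph \<Rightarrow> 't \<Rightarrow> 't \<Rightarrow> 't \<Rightarrow> bool" where
  "parent T r t' t \<longleftrightarrow> (\<exists>p e. pre_digraph.apath T r (p @ [e]) t \<and> tail T e = t')"

definition rooted_tree_decomposition ::
  "('a,'b) pre_digraph \<Rightarrow> ('t,'e) pre_digraph \<Rightarrow> 't \<Rightarrow> ('t \<Rightarrow> 'a set) \<Rightarrow> bool" where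
  "rooted_tree_decomposition G T r \<beta> \<longleftrightarrow> rooted_tree T r \<and>
     (\<forall>t\<in>verts T. \<beta> t \<subseteq> verts G) \<and>
     (\<forall>e\<in>arcs G. \<exists>t\<in>verts T. {tail G e, head G e} \<subseteq> \<beta> t) \<and>
     (\<forall>v\<in>verts G. connected (T \<restriction> {t \<in> verts T. v \<in> \<beta> t}))"

definition guarded_tree_decomposition ::
  "('a,'b) pre_digraph \<Rightarrow> ('t,'e) pre_digraph \<Rightarrow> 't \<Rightarrow> ('t \<Rightarrow> 'a set) \<Rightarrow> ('t \<Rightarrow> 'a set) \<Rightarrow> bool" where
  "guarded_tree_decomposition G T r \<beta> \<gamma> \<longleftrightarrow> rooted_tree_decomposition G T r \<beta> \<and>
     (\<forall>t\<in>verts T. \<gamma> t \<subseteq> \<beta> t) \<and>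
     (\<forall>t\<in>verts T. \<forall>t'\<in>verts T. parent T r t' t \<longrightarrow> \<beta> t \<inter> \<beta> t' \<subseteq> \<gamma> t)"

text \<open>As \<open>G\<close> may be infinite, having a natural number as vigilance includes finiteness of the guards.\<close>

definition has_vigilance :: "('t,'e) pre_digraph \<Rightarrow> ('t \<Rightarrow> 'a set) \<Rightarrow> nat \<Rightarrow> bool" where
  "has_vigilance T \<gamma> l \<longleftrightarrow>
     (\<forall>t\<in>verts T. finite (\<gamma> t)) \<and> Max ((\<lambda>t. card (\<gamma> t)) ` verts T) = l"

definition distance_guards ::
  "('a,'b) pre_digraph \<Rightarrow> ('t,'e) pre_digraph \<Rightarrow> ('t \<Rightarrow> 'a set) \<Rightarrow> ('t \<Rightarrow> 'a set) \<Rightarrow> nat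
    \<Rightarrow> ('a,'b) pre_digraph set \<Rightarrow> bool" where
  "distance_guards G T \<beta> \<gamma> d \<H> \<longleftrightarrow> (\<forall>H\<in>\<H>. \<forall>t\<in>verts T.
     verts H \<inter> \<beta> t \<noteq> {} \<longrightarrow> verts H \<inter> graph_ball G d (\<gamma> t) \<noteq> {})"

end

theory Submission
  imports Defs
begin

text \<open>
  The nodes whose bags meet a member \<open>H\<close> of the family induce a connected subtree; let \<open>t\<^sub>H\<close> be its
  topmost node. Take \<open>H\<close> with \<open>t\<^sub>H\<close> of maximal depth, discard all members met by the \<open>d\<close>-ball around
  \<open>\<gamma>(t\<^sub>H)\<close>, and repeat. A surviving \<open>H'\<close> avoids the bag of \<open>t\<^sub>H\<close> because of guarding, and therefore,
  by maximality of the depth, all bags below \<open>t\<^sub>H\<close>. So every path from \<open>H\<close> to \<open>H'\<close> leaves the part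
  below \<open>t\<^sub>H\<close> through a vertex of \<open>\<gamma>(t\<^sub>H)\<close>, and is longer than \<open>d\<close>. Hence the chosen members are
  scattered, and if fewer than \<open>k\<close> are chosen, then the guards of their top nodes form \<open>X\<close>.
\<close>

section \<open>Greedy selection in abstract form\<close>

text \<open>Each round picks \<open>x\<close> and keeps the elements it does not hit. All of these
  are far from \<open>x\<close>, so \<open>x\<close> extends any packing among them; otherwise
  \<open>x\<close> joins a cover of them and takes care of the dropped elements. By
  \<open>hit_refl\<close>, \<open>x\<close> itself is dropped, so a packing really grows.\<close>

lemma greedy_packing_or_covering:
  assumes hit_refl: "\<And>x. x \<in> A \<Longrightarrow> hit x x"
    and far_sym: "\<And>x y. far x y \<Longrightarrow> far y x"
    and pick: "\<And>F. \<lbrakk>F \<subseteq> A; F \<noteq> {}\<rbrakk> \<Longrightarrow> \<exists>x\<in>F. \<forall>y\<in>F. hit x y \<or> far x y"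
  shows "(\<exists>S\<subseteq>A. finite S \<and> card S = k \<and> pairwise far S) \<or>
    (\<exists>S\<subseteq>A. finite S \<and> card S < k \<and> (\<forall>y\<in>A. \<exists>x\<in>S. hit x y))"
  using hit_refl pick
proof (induction k arbitrary: A)
  case 0
  then show ?case by (intro disjI1 exI[of _ "{}"]) auto
next
  case (Suc k)
  show ?case
  proof (cases "A = {}")
    case True
    then show ?thesis by (intro disjI2 exI[of _ "{}"]) auto
  next
    case False
    then obtain x where x: "x \<in> A" and far: "\<And>y. y \<in> A \<Longrightarrow> hit x y \<or> far x y"
      using Suc.prems(2)[of A] by auto
    define B where "B = {y \<in> A. \<not> hit x y}"
    have B: "B \<subseteq> A" and xB: "x \<notin> B"
      using x Suc.prems(1) by (auto simp: B_def)
    have "(\<exists>S\<subseteq>B. finite S \<and> card S = k \<and> pairwise far S) \<or>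
        (\<exists>S\<subseteq>B. finite S \<and> card S < k \<and> (\<forall>y\<in>B. \<exists>x\<in>S. hit x y))"
    proof (rule Suc.IH)
      show "hit y y" if "y \<in> B" for y
        using that B Suc.prems(1) by blast
      show "\<exists>x\<in>F. \<forall>y\<in>F. hit x y \<or> far x y" if "F \<subseteq> B" "F \<noteq> {}" for F
        using that B by (intro Suc.prems(2)) auto
    qed
    then consider S where "S \<subseteq> B" "finite S" "card S = k" "pairwise far S"
      | S where "S \<subseteq> B" "finite S" "card S < k" "\<forall>y\<in>B. \<exists>x\<in>S. hit x y"
      by blast
    then show ?thesis
    proof cases
      case 1
      have "pairwise far (insert x S)"
        using 1 far B far_sym by (auto simp: pairwise_insert B_def)
      with 1 x B xB show ?thesis
        by (intro disjI1 exI[of _ "insert x S"]) (auto simp: card_insert_if)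
    next
      case 2
      with x B show ?thesis
        by (intro disjI2 exI[of _ "insert x S"]) (auto simp: card_insert_if B_def)
    qed
  qed
qed

section \<open>Distances and balls in terms of walks\<close>

context wf_digraph
begin

text \<open>Strict bounds can be lost under an infimum. Walk lengths are integers, so the gap up to
  \<open>d + 1\<close> is uniform and survives the infimum over walks, and in
  \<open>INF_gdist_gt\<close> also the one over pairs of vertices.\<close>

lemma gdist_geI:
  assumes "\<And>p. awalk u p v \<Longrightarrow> d < length p"
  shows "ereal (real d + 1) \<le> gdist G u v"
  unfolding gdist_def \<mu>_def awalk_cost_def
proof (rule INF_greatest)
  fix p assume "p \<in> {p. awalk u p v}"
  then have "d < length p" using assms by simp
  then have "real d + 1 \<le> real (length p)" by linarith
  then show "ereal (real d + 1) \<le> ereal (sum_list (map (\<lambda>_. 1) p))"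
    by (simp add: sum_list_triv)
qed

lemma gdist_le_iff:
  "gdist G u v \<le> ereal (real d) \<longleftrightarrow> (\<exists>p. awalk u p v \<and> length p \<le> d)"
proof
  assume le: "gdist G u v \<le> ereal (real d)"
  show "\<exists>p. awalk u p v \<and> length p \<le> d"
  proof (rule ccontr)
    assume "\<not> ?thesis"
    then have "ereal (real d + 1) \<le> gdist G u v"
      by (intro gdist_geI) (auto simp: not_le)
    from order_trans[OF this le] show False by simp
  qed
next
  assume "\<exists>p. awalk u p v \<and> length p \<le> d"
  then obtain p where "awalk u p v" "length p \<le> d" by auto
  then show "gdist G u v \<le> ereal (real d)"
    unfolding gdist_def \<mu>_def awalk_cost_def
    by (intro INF_lower2[of p]) (auto simp: sum_list_triv)
qed

lemma INF_gdist_gt: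
  assumes "\<And>u v p. \<lbrakk>u \<in> A; v \<in> B; awalk u p v\<rbrakk> \<Longrightarrow> d < length p"
  shows "(INF (u, v) \<in> A \<times> B. gdist G u v) > ereal (real d)"
proof -
  have "ereal (real d + 1) \<le> (INF (u, v) \<in> A \<times> B. gdist G u v)"
    by (rule INF_greatest) (use assms in \<open>auto intro: gdist_geI\<close>)
  then show ?thesis by (rule less_le_trans[rotated]) simp
qed

lemma graph_ball_iff:
  "v \<in> graph_ball G d X \<longleftrightarrow> (\<exists>x\<in>X. \<exists>p. awalk x p v \<and> length p \<le> d)"
  by (auto simp: graph_ball_def gdist_le_iff dest: awalk_last_in_verts)

text \<open>Along a walk inside \<open>C\<close> from \<open>x\<close>, either the current vertex is
  still in \<open>D\<close> or a step out of \<open>D\<close> has already occurred.\<close>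

lemma strongly_connected_induce_crossing:
  assumes "strongly_connected (G \<restriction> C)" "x \<in> C" "x \<in> D" "y \<in> C" "y \<notin> D"
  obtains a b where "a \<in> C \<inter> D" "b \<in> C - D" "a \<rightarrow>\<^bsub>G\<^esub> b"
proof -
  have "x \<rightarrow>\<^sup>*\<^bsub>G \<restriction> C\<^esub> y"
    using assms by (auto simp: strongly_connected_def)
  then have "y \<in> D \<or> (\<exists>a\<in>C \<inter> D. \<exists>b\<in>C - D. a \<rightarrow>\<^bsub>G\<^esub> b)"
    unfolding reachable_def
  proof (induct rule: rtrancl_on_induct)
    case (step y z)
    then show ?case by (auto dest: dominates_induce_subgraphD)
  qed (use assms(3) in blast)
  with assms that show ?thesis by blast
qed

end

section \<open>Reversal and connectivity in symmetric digraphs\<close>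

context sym_digraph
begin

lemma awalk_reverse:
  assumes "awalk u p v"
  shows "\<exists>q. awalk v q u \<and> length q = length p"
  using assms
proof (induction p arbitrary: u)
  case Nil
  then show ?case by (auto simp: awalk_Nil_iff)
next
  case (Cons e p)
  then obtain q where q: "awalk v q (head G e)" "length q = length p"
    by (auto simp: awalk_Cons_iff)
  obtain e' where "e' \<in> arcs G" "tail G e' = head G e" "head G e' = tail G e"
    using Cons.prems sym_arcs by (fastforce simp: awalk_Cons_iff symmetric_conv)
  with q Cons.prems have "awalk v (q @ [e']) u"
    by (auto simp: awalk_simps)
  with q show ?case
    by (intro exI[of _ "q @ [e']"]) simp
qed

lemma symmetric_induce: "symmetric (G \<restriction> S)"
  unfolding symmetric_conv
proof
  fix e assume e: "e \<in> arcs (G \<restriction> S)"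
  then obtain e' where "e' \<in> arcs G" "tail G e = head G e'" "head G e = tail G e'"
    using sym_arcs by (auto simp: symmetric_conv)
  with e show "\<exists>e'\<in>arcs (G \<restriction> S). tail (G \<restriction> S) e = head (G \<restriction> S) e' \<and>
      head (G \<restriction> S) e = tail (G \<restriction> S) e'"
    by auto
qed

text \<open>\<open>connected\<close> speaks of the symmetric closure; by symmetry it yields
  reachability along actual arcs, which the later inductions follow.\<close>

lemma connected_induceD: "connected (G \<restriction> S) \<Longrightarrow> strongly_connected (G \<restriction> S)"
  by (rule wf_digraph.symmetric_connected_imp_strongly_connected
      [OF wellformed_induce_subgraph symmetric_induce])

lemma dominates_sym: "u \<rightarrow>\<^bsub>G\<^esub> v \<Longrightarrow> v \<rightarrow>\<^bsub>G\<^esub> u"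
  by (rule arcs_ends_symmetric[OF sym_arcs])

end

section \<open>Depth and the subtree below a node\<close>

text \<open>In a tree rooted at \<open>r\<close>, this is the subtree hanging from \<open>t\<close>.\<close>

definition below :: "('t,'e) pre_digraph \<Rightarrow> 't \<Rightarrow> 't \<Rightarrow> 't set" where
  "below T r t = {s \<in> verts T. \<not> r \<rightarrow>\<^sup>*\<^bsub>T \<restriction> (verts T - {t})\<^esub> s}"

text \<open>Measured by shortest walks, so that prefixes of walks give upper bounds. The value is
  unspecified if no walk exists, hence the reachability assumption in
  \<open>depth_walk\<close>.\<close>

definition depth :: "('t,'e) pre_digraph \<Rightarrow> 't \<Rightarrow> 't \<Rightarrow> nat" where
  "depth T r t = (LEAST n. \<exists>p. pre_digraph.awalk T r p t \<and> length p = n)"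

text \<open>Reachability requires its endpoint to be a vertex, and \<open>t\<close> has been
  deleted. For \<open>t = r\<close> every node counts as below.\<close>

lemma below_self: "t \<in> verts T \<Longrightarrow> t \<in> below T r t"
  by (auto simp: below_def reachable_def dest: in_rtrancl_on_in_F)

context wf_digraph
begin

lemma depth_le: "awalk r p t \<Longrightarrow> depth G r t \<le> length p"
  unfolding depth_def by (rule Least_le) blast

lemma depth_walk:
  assumes "r \<rightarrow>\<^sup>* t"
  obtains p where "awalk r p t" "length p = depth G r t"
proof -
  have "\<exists>n p. awalk r p t \<and> length p = n"
    using assms by (auto simp: reachable_awalk)
  then have "\<exists>p. awalk r p t \<and> length p = depth G r t"
    unfolding depth_def by (rule LeastI_ex)
  with that show thesis by blast
qed

lemma reachable_induce_apathE:
  assumes "u \<rightarrow>\<^sup>*\<^bsub>G \<restriction> S\<^esub> v" "S \<subseteq> verts G"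
  obtains p where "apath u p v" "set (awalk_verts u p) \<subseteq> S"
proof -
  interpret S: wf_digraph "G \<restriction> S" by auto
  obtain p where p: "S.apath u p v"
    using assms(1) by (auto simp: S.reachable_apath)
  have "apath u p v"
    using p subgraph_induce_subgraphI[OF assms(2)] by (rule subgraph_apath_imp_apath)
  moreover have "set (awalk_verts u p) \<subseteq> S"
    using p by (auto simp: S.apath_def S.awalk_conv awalk_verts_induce)
  ultimately show thesis by (rule that)
qed

lemma not_belowE:
  assumes "s \<in> verts G" "s \<notin> below G r t"
  obtains p where "apath r p s" "t \<notin> set (awalk_verts r p)"
proof -
  have "r \<rightarrow>\<^sup>*\<^bsub>G \<restriction> (verts G - {t})\<^esub> s"
    using assms by (simp add: below_def)
  then obtain p where "apath r p s" "set (awalk_verts r p) \<subseteq> verts G - {t}"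
    by (rule reachable_induce_apathE) auto
  with that show thesis by blast
qed

lemma reachable_induceI:
  assumes "awalk u p v" "set (awalk_verts u p) \<subseteq> S"
  shows "u \<rightarrow>\<^sup>*\<^bsub>G \<restriction> S\<^esub> v"
proof -
  interpret S: wf_digraph "G \<restriction> S" by auto
  show ?thesis using awalk_induce[OF assms] by (rule S.reachable_awalkI)
qed

lemma below_awalk:
  assumes "s \<in> below G r t" "awalk r p s"
  shows "t \<in> set (awalk_verts r p)"
proof (rule ccontr)
  assume "t \<notin> set (awalk_verts r p)"
  with assms(2) have "r \<rightarrow>\<^sup>*\<^bsub>G \<restriction> (verts G - {t})\<^esub> s"
    by (intro reachable_induceI) auto
  with assms(1) show False by (simp add: below_def)
qed

text \<open>A shortest walk from \<open>r\<close> to \<open>u\<close> passes through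
  \<open>t\<close>, and the part after \<open>t\<close> is non-empty.\<close>

lemma depth_below_less:
  assumes "u \<in> below G r t" "u \<noteq> t" "r \<rightarrow>\<^sup>* u"
  shows "depth G r t < depth G r u"
proof -
  obtain p where p: "awalk r p u" "length p = depth G r u"
    using assms(3) by (rule depth_walk)
  then have "t \<in> set (awalk_verts r p)"
    using assms(1) by (blast intro: below_awalk)
  then obtain q s where qs: "p = q @ s" "awalk r q t" "awalk t s u"
    using awalk_decomp[OF p(1)] by metis
  then have "s \<noteq> []" using assms(2) by (auto simp: awalk_Nil_iff)
  with qs p(2) depth_le[of r q t] show ?thesis by (cases s) auto
qed

end

section \<open>Leaving a subtree, and tops of connected node sets\<close>

context sym_digraph
begin

text \<open>Extend a path from \<open>r\<close> to \<open>b\<close> that avoids \<open>t\<close> by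
  the arc back to \<open>a\<close>. This walk must meet \<open>t\<close>, which is only possible at
  its last vertex. So \<open>a = t\<close>, and the walk is a path witnessing
  \<open>parent\<close>.\<close>

lemma below_exit:
  assumes a: "a \<in> below G r t" and b: "b \<notin> below G r t" and ab: "a \<rightarrow>\<^bsub>G\<^esub> b"
  shows "a = t \<and> parent G r b t"
proof -
  have "b \<in> verts G" using ab by (rule adj_in_verts)
  then obtain p where p: "apath r p b" and tp: "t \<notin> set (awalk_verts r p)"
    using b by (rule not_belowE)
  obtain e where e: "e \<in> arcs G" "tail G e = b" "head G e = a"
    using dominates_sym[OF ab] by auto
  have w: "awalk r (p @ [e]) a"
    using p e by (auto simp: apath_def awalk_simps)
  have verts: "awalk_verts r (p @ [e]) = awalk_verts r p @ [a]"
    using awalk_verts_append[OF w] e by simp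
  with below_awalk[OF a w] tp have at: "a = t" by auto
  then have "apath r (p @ [e]) t"
    using p w verts tp by (simp add: apath_def)
  then show ?thesis using at e by (auto simp: parent_def)
qed

text \<open>By \<open>below_exit\<close>, a connected set can cross the boundary of the subtree only
  at \<open>t\<close>.\<close>

lemma connected_subset_below:
  assumes "strongly_connected (G \<restriction> C)" "t \<notin> C" "C \<inter> below G r t \<noteq> {}"
  shows "C \<subseteq> below G r t"
proof (rule ccontr)
  assume "\<not> C \<subseteq> below G r t"
  with assms obtain x y where "x \<in> C" "x \<in> below G r t" "y \<in> C" "y \<notin> below G r t" by auto
  then obtain a b where "a \<in> C \<inter> below G r t" "b \<in> C - below G r t" "a \<rightarrow>\<^bsub>G\<^esub> b"
    by (rule strongly_connected_induce_crossing[OF assms(1)])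
  with below_exit[of a r t b] assms(2) show False by auto
qed

text \<open>The top of \<open>C\<close> is its node of least depth. If some node of \<open>C\<close> could be reached from the root
  without passing through it, then there would be a path between two of its neighbours, the one
  before it on a shortest path from the root and one inside \<open>C\<close>, that avoids it, hence a cycle.\<close>

lemma acyclic_connected_top:
  assumes acyclic: "\<not> (\<exists>p. cycle p \<and> length p \<ge> 3)"
    and conn: "strongly_connected G" and r: "r \<in> verts G"
    and C: "C \<subseteq> verts G" "strongly_connected (G \<restriction> C)"
  obtains t where "t \<in> C" "C \<subseteq> below G r t"
proof -
  have "C \<noteq> {}" using C(2) by (auto simp: strongly_connected_def)
  then obtain t where t: "t \<in> C" and t_min: "\<And>s. s \<in> C \<Longrightarrow> depth G r t \<le> depth G r s"
    using ex_has_least_nat[of "\<lambda>x. x \<in> C" _ "depth G r"] by blast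
  have "s \<in> below G r t" if s: "s \<in> C" for s
  proof (rule ccontr)
    let ?V = "verts G - {t}"
    interpret V: wf_digraph "G \<restriction> ?V" by auto
    assume not_below: "s \<notin> below G r t"
    then have st: "s \<noteq> t" and rs: "r \<rightarrow>\<^sup>*\<^bsub>G \<restriction> ?V\<^esub> s"
      using t s C(1) below_self[of t G r] by (auto simp: below_def)
    have "r \<rightarrow>\<^sup>* t" using conn r t C(1) by (auto simp: strongly_connected_def)
    then obtain p where p: "awalk r p t" "length p = depth G r t" by (rule depth_walk)
    \<comment> \<open>The walk behind \<open>rs\<close> starts in \<open>?V\<close>, so
      \<open>t\<close> is not the root and has a predecessor \<open>b\<close> on
      \<open>p\<close>.\<close>
    have "r \<in> ?V" using V.reachable_in_verts(1)[OF rs] by simp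
    then have "p \<noteq> []" using p(1) by (auto simp: awalk_Nil_iff)
    then obtain p' f where pf: "p = p' @ [f]" by (cases p rule: rev_cases) auto
    define b where "b = tail G f"
    have f: "f \<in> arcs G" "head G f = t" and p': "awalk r p' b"
      using p(1) by (auto simp: pf b_def awalk_simps)
    \<comment> \<open>Nodes on the shortest walk before \<open>t\<close> have smaller depth, so
      minimality keeps them outside \<open>C\<close>.\<close>
    have before: "x \<notin> C" if x: "x \<in> set (awalk_verts r p')" for x
    proof -
      obtain q q' where q: "p' = q @ q'" "awalk r q x"
        using awalk_decomp[OF p' x] by blast
      have "depth G r x \<le> length q" using q(2) by (rule depth_le)
      also have "\<dots> < depth G r t" using p(2) q(1) pf by simp
      finally show ?thesis using t_min[of x] by fastforce
    qed
    have rb: "r \<rightarrow>\<^sup>*\<^bsub>G \<restriction> ?V\<^esub> b"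
      using p' before t by (intro reachable_induceI[OF p']) auto
    have "b \<in> set (awalk_verts r p')"
      using p' by (metis awalkE awalk_verts_non_Nil last_in_set)
    then have b: "b \<notin> C" by (rule before)
    have "t \<rightarrow>\<^sup>*\<^bsub>G \<restriction> C\<^esub> s"
      using C(2) t s by (auto simp: strongly_connected_def)
    then obtain w where w: "apath t w s" "set (awalk_verts t w) \<subseteq> C"
      using C(1) by (rule reachable_induce_apathE)
    with st obtain g w' where gw: "w = g # w'" by (cases w) (auto simp: apath_simps)
    \<comment> \<open>\<open>c\<close> is the neighbour of \<open>t\<close> inside \<open>C\<close>.
      The route from \<open>c\<close> via \<open>s\<close> and \<open>r\<close> to \<open>b\<close>
      avoids \<open>t\<close>, and closing it up through \<open>t\<close> gives the cycle.\<close>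
    define c where "c = head G g"
    have g: "g \<in> arcs G" "tail G g = t" and w': "apath c w' s" "t \<notin> set (awalk_verts c w')"
      using w(1) by (auto simp: gw c_def apath_simps)
    have c: "c \<in> C" using w(2) w'(1) hd_in_awalk_verts(2) by (auto simp: gw c_def)
    have "awalk c w' s" using w'(1) by (rule awalkI_apath)
    then have "c \<rightarrow>\<^sup>*\<^bsub>G \<restriction> ?V\<^esub> s"
      using w'(2) by (intro reachable_induceI) auto
    also have "s \<rightarrow>\<^sup>*\<^bsub>G \<restriction> ?V\<^esub> r"
      using symmetric_induce rs by (rule symmetric_reachable)
    also note rb
    finally obtain z where z: "apath c z b" "set (awalk_verts c z) \<subseteq> ?V"
      by (rule reachable_induce_apathE) auto
    \<comment> \<open>\<open>c\<close> lies in \<open>C\<close> and \<open>b\<close> does not. This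
      makes the cycle have length at least 3, excluding an arc followed by its reverse.\<close>
    have "z \<noteq> []" using z(1) b c by (auto simp: apath_simps)
    have cz: "awalk c (z @ [f]) t"
      using awalkI_apath[OF z(1)] f by (auto simp: b_def awalk_simps)
    have "awalk_verts c (z @ [f]) = awalk_verts c z @ [t]"
      using awalk_verts_append[OF cz] f by simp
    then have "distinct (awalk_verts c (z @ [f]))"
      using z by (auto simp: apath_def)
    \<comment> \<open>\<open>cycle\<close> asks for distinctness only after the first vertex, that
      is, along \<open>z @ [f]\<close> from \<open>c\<close>.\<close>
    then have "cycle (g # z @ [f])"
      unfolding cycle_def using cz g by (intro exI[of _ t]) (simp add: awalk_Cons_iff c_def del: awalk_append_iff)
    moreover have "length (g # z @ [f]) \<ge> 3"
      using \<open>z \<noteq> []\<close> by (cases z) auto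
    ultimately show False using acyclic by blast
  qed
  with t that show thesis by blast
qed

end

section \<open>Guarded tree-decompositions\<close>

locale guarded_decomposition = G: simple_graph G + T: graph T
  for G :: "('a,'b) pre_digraph" and T :: "('t,'e) pre_digraph" +
  fixes r :: 't and \<beta> \<gamma> :: "'t \<Rightarrow> 'a set"
  assumes guarded: "guarded_tree_decomposition G T r \<beta> \<gamma>"
begin

definition nodes :: "'a set \<Rightarrow> 't set" where
  "nodes A = {t \<in> verts T. A \<inter> \<beta> t \<noteq> {}}"

lemma nodes_subset: "nodes A \<subseteq> verts T"
  by (auto simp: nodes_def)

lemma bag_subset: "t \<in> verts T \<Longrightarrow> \<beta> t \<subseteq> verts G"
  and guard_subset: "t \<in> verts T \<Longrightarrow> \<gamma> t \<subseteq> \<beta> t"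
  and adhesion_subset: "\<lbrakk>s \<in> verts T; t \<in> verts T; parent T r s t\<rbrakk> \<Longrightarrow> \<beta> t \<inter> \<beta> s \<subseteq> \<gamma> t"
  and arc_in_bag: "e \<in> arcs G \<Longrightarrow> \<exists>t\<in>verts T. tail G e \<in> \<beta> t \<and> head G e \<in> \<beta> t"
  using guarded unfolding guarded_tree_decomposition_def rooted_tree_decomposition_def by auto

lemma root: "r \<in> verts T"
  and tree_acyclic: "\<not> (\<exists>p. T.cycle p \<and> length p \<ge> 3)"
  and tree_connected: "strongly_connected T"
  using guarded T.symmetric_connected_imp_strongly_connected[OF T.sym_arcs]
  unfolding guarded_tree_decomposition_def rooted_tree_decomposition_def rooted_tree_def by auto

lemma vertex_nodes_connected:
  assumes "v \<in> verts G"
  shows "strongly_connected (T \<restriction> nodes {v})"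
proof -
  have "nodes {v} = {t \<in> verts T. v \<in> \<beta> t}" by (auto simp: nodes_def)
  then show ?thesis
    using assms guarded T.connected_induceD
    unfolding guarded_tree_decomposition_def rooted_tree_decomposition_def by auto
qed

text \<open>The ends of an arc share a bag, so the subtrees of consecutive vertices on a walk in
  \<open>H\<close> overlap, and their union is connected.\<close>

lemma subgraph_nodes_connected:
  assumes H: "subgraph H G" "strongly_connected H"
  shows "strongly_connected (T \<restriction> nodes (verts H))"
proof -
  let ?N = "nodes (verts H)"
  interpret N: wf_digraph "T \<restriction> ?N" by auto
  have HG: "verts H \<subseteq> verts G" using H(1) by auto
  have same: "s \<rightarrow>\<^sup>*\<^bsub>T \<restriction> ?N\<^esub> t" if "v \<in> verts H" "s \<in> nodes {v}" "t \<in> nodes {v}" for v s t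
  proof (rule T.reachable_induce_ss)
    show "s \<rightarrow>\<^sup>*\<^bsub>T \<restriction> nodes {v}\<^esub> t"
      using vertex_nodes_connected[of v] that HG by (auto simp: strongly_connected_def)
    show "nodes {v} \<subseteq> ?N" using that(1) by (auto simp: nodes_def)
  qed
  \<comment> \<open>Quantifying over all nodes of \<open>w\<close> lets the induction step pass
    through the node whose bag holds the next arc.\<close>
  have reach: "\<forall>t\<in>nodes {w}. s \<rightarrow>\<^sup>*\<^bsub>T \<restriction> ?N\<^esub> t"
    if "v \<rightarrow>\<^sup>*\<^bsub>H\<^esub> w" and s: "s \<in> nodes {v}" for v w s
    using that(1) unfolding reachable_def[of H]
  proof (induct rule: rtrancl_on_induct)
    case base
    then show ?case using same s by blast
  next
    case (step y z)
    have "(y, z) \<in> arcs_ends G" using step(2) arcs_ends_mono[OF H(1)] by blast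
    then obtain t' where t': "t' \<in> verts T" "y \<in> \<beta> t'" "z \<in> \<beta> t'"
      using arc_in_bag by (fastforce simp: arcs_ends_conv)
    then have st': "s \<rightarrow>\<^sup>*\<^bsub>T \<restriction> ?N\<^esub> t'" using step(5) by (auto simp: nodes_def)
    show ?case
    proof
      fix t assume "t \<in> nodes {z}"
      then have "t' \<rightarrow>\<^sup>*\<^bsub>T \<restriction> ?N\<^esub> t" using same[of z t' t] step(4) t' by (auto simp: nodes_def)
      with st' show "s \<rightarrow>\<^sup>*\<^bsub>T \<restriction> ?N\<^esub> t" by (rule N.reachable_trans)
    qed
  qed
  show ?thesis
    unfolding strongly_connected_def
  proof (intro conjI ballI)
    obtain v where "v \<in> verts H" using H(2) by (auto simp: strongly_connected_def)
    moreover from this have "nodes {v} \<noteq> {}"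
      using vertex_nodes_connected[of v] HG by (auto simp: strongly_connected_def)
    ultimately show "verts (T \<restriction> ?N) \<noteq> {}" by (auto simp: nodes_def)
  next
    fix s t assume "s \<in> verts (T \<restriction> ?N)" "t \<in> verts (T \<restriction> ?N)"
    then obtain v w where "v \<in> verts H" "w \<in> verts H" "s \<in> nodes {v}" "t \<in> nodes {w}"
      by (auto simp: nodes_def)
    then show "s \<rightarrow>\<^sup>*\<^bsub>T \<restriction> ?N\<^esub> t"
      using reach[of v w s] H(2) by (auto simp: strongly_connected_def)
  qed
qed

text \<open>Consider the first arc of the walk whose head has no node below \<open>t\<close>. A bag
  containing both its ends lies outside the subtree, so the nodes of its tail occur on both sides
  and the tail lies in the bags of \<open>t\<close> and its parent, hence in the guard. The rest of
  the walk from this tail serves as \<open>q\<close>.\<close>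

lemma awalk_leaves_below_through_guard:
  assumes "G.awalk v p w" "nodes {v} \<inter> below T r t \<noteq> {}" "nodes {w} \<inter> below T r t = {}"
  shows "\<exists>x\<in>\<gamma> t. \<exists>q. G.awalk x q w \<and> length q \<le> length p"
  using assms
proof (induction p arbitrary: v)
  case Nil
  then show ?case by (auto simp: G.awalk_Nil_iff)
next
  case (Cons e p)
  have e: "e \<in> arcs G" "v = tail G e" and p: "G.awalk (head G e) p w"
    using Cons.prems(1) by (auto simp: G.awalk_Cons_iff)
  show ?case
  proof (cases "nodes {head G e} \<inter> below T r t = {}")
    case False
    with Cons.IH[OF p] Cons.prems(3) show ?thesis by fastforce
  next
    case True
    obtain u where u: "u \<in> verts T" "v \<in> \<beta> u" "head G e \<in> \<beta> u"
      using arc_in_bag[OF e(1)] e(2) by auto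
    then have "u \<notin> below T r t" "u \<in> nodes {v}" using True by (auto simp: nodes_def)
    moreover obtain s where "s \<in> nodes {v}" "s \<in> below T r t" using Cons.prems(2) by auto
    moreover have "strongly_connected (T \<restriction> nodes {v})"
      using e by (auto intro: vertex_nodes_connected)
    ultimately obtain a b where ab: "a \<in> nodes {v} \<inter> below T r t" "b \<in> nodes {v} - below T r t"
        "a \<rightarrow>\<^bsub>T\<^esub> b"
      using T.strongly_connected_induce_crossing by metis
    then have "a = t" "parent T r b t"
      using T.below_exit[of a r t b] by auto
    with ab have "v \<in> \<gamma> t"
      using adhesion_subset[of b t] by (auto simp: nodes_def)
    with Cons.prems(1) show ?thesis by blast
  qed
qed

lemma packing_or_covering:
  assumes \<H>: "\<H> \<subseteq> connected_subgraphs G"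
    and guards: "distance_guards G T \<beta> \<gamma> d \<H>"
    and vigilance: "\<And>t. t \<in> verts T \<Longrightarrow> finite (\<gamma> t) \<and> card (\<gamma> t) \<le> l"
  shows "(\<exists>\<H>'\<subseteq>\<H>. finite \<H>' \<and> card \<H>' = k \<and> scattered G d \<H>') \<or>
    (\<exists>X\<subseteq>verts G. finite X \<and> int (card X) \<le> int l * (int k - 1) \<and>
      (\<forall>H\<in>\<H>. verts H \<inter> graph_ball G d X \<noteq> {}))"
proof -
  have conn: "strongly_connected (T \<restriction> nodes (verts H))" if "H \<in> \<H>" for H
  proof (rule subgraph_nodes_connected)
    have H: "subgraph H G" "symmetric H" "connected H"
      using \<H> that by (auto simp: connected_subgraphs_def)
    then show "strongly_connected H"
      by (intro wf_digraph.symmetric_connected_imp_strongly_connected) auto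
    show "subgraph H G" by fact
  qed
  have "\<exists>t. t \<in> nodes (verts H) \<and> nodes (verts H) \<subseteq> below T r t" if "H \<in> \<H>" for H
    using T.acyclic_connected_top[OF tree_acyclic tree_connected root nodes_subset conn[OF that]]
    by blast
  then obtain top where top: "\<And>H. H \<in> \<H> \<Longrightarrow> top H \<in> nodes (verts H)"
    and below_top: "\<And>H. H \<in> \<H> \<Longrightarrow> nodes (verts H) \<subseteq> below T r (top H)"
    by metis
  have top_verts: "top H \<in> verts T" if "H \<in> \<H>" for H
    using top[OF that] nodes_subset by blast
  define hit where "hit H H' \<longleftrightarrow> verts H' \<inter> graph_ball G d (\<gamma> (top H)) \<noteq> {}"
    for H H' :: "('a,'b) pre_digraph"
  \<comment> \<open>Stated by walks, to match the exit lemma; \<open>INF_gdist_gt\<close> converts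
    it to \<open>scattered\<close> at the end.\<close>
  define far where "far H H' \<longleftrightarrow>
    (\<forall>u\<in>verts H. \<forall>v\<in>verts H'. \<forall>p. G.awalk u p v \<longrightarrow> d < length p)"
    for H H' :: "('a,'b) pre_digraph"
  have guarded_hit: "verts H' \<inter> graph_ball G d (\<gamma> t) \<noteq> {}" if "H' \<in> \<H>" "t \<in> nodes (verts H')" for H' t
    using guards that by (auto simp: distance_guards_def nodes_def)
  have far: "far H H'"
    if H: "H \<in> \<H>" "H' \<in> \<H>" and le: "depth T r (top H') \<le> depth T r (top H)"
      and not_hit: "\<not> hit H H'" for H H'
  proof -
    have notin: "top H \<notin> nodes (verts H')"
      using not_hit guarded_hit[OF H(2)] by (auto simp: hit_def)
    have disjoint: "nodes (verts H') \<inter> below T r (top H) = {}"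
    proof (rule ccontr)
      \<comment> \<open>Avoiding \<open>top H\<close>, the nodes of \<open>H'\<close> would all lie
        below it, making \<open>top H'\<close> strictly deeper.\<close>
      assume "\<not> ?thesis"
      with conn[OF H(2)] notin have "nodes (verts H') \<subseteq> below T r (top H)"
        by (rule T.connected_subset_below)
      then have "depth T r (top H) < depth T r (top H')"
        using top[OF H(2)] notin tree_connected root top_verts[OF H(2)]
        by (intro T.depth_below_less) (auto simp: strongly_connected_def)
      with le show False by simp
    qed
    show "far H H'"
      unfolding far_def
    proof (intro ballI allI impI, rule ccontr)
      fix u v p assume u: "u \<in> verts H" and v: "v \<in> verts H'" and p: "G.awalk u p v"
        and "\<not> d < length p"
      \<comment> \<open>Every vertex has a node. So \<open>u\<close> has one below
        \<open>top H\<close> while \<open>v\<close> has none, and the walk passes through the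
        guard.\<close>
      have "nodes {u} \<noteq> {}"
        using vertex_nodes_connected[OF G.awalk_hd_in_verts[OF p]]
        by (auto simp: strongly_connected_def)
      moreover have "nodes {u} \<subseteq> nodes (verts H)" "nodes {v} \<subseteq> nodes (verts H')"
        using u v by (auto simp: nodes_def)
      ultimately obtain x q where "x \<in> \<gamma> (top H)" "G.awalk x q v" "length q \<le> length p"
        using awalk_leaves_below_through_guard[OF p, of "top H"] below_top[OF H(1)] disjoint
        by blast
      then have "v \<in> graph_ball G d (\<gamma> (top H))"
        using \<open>\<not> d < length p\<close> unfolding G.graph_ball_iff
        by (intro bexI[of _ x] exI[of _ q]) auto
      with v not_hit show False by (auto simp: hit_def)
    qed
  qed
  have "(\<exists>S\<subseteq>\<H>. finite S \<and> card S = k \<and> pairwise far S) \<or>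
    (\<exists>S\<subseteq>\<H>. finite S \<and> card S < k \<and> (\<forall>H'\<in>\<H>. \<exists>H\<in>S. hit H H'))"
  proof (rule greedy_packing_or_covering)
    show "hit H H" if "H \<in> \<H>" for H
      using guarded_hit[OF that top[OF that]] by (simp add: hit_def)
    show "far H' H" if "far H H'" for H H'
      using that G.awalk_reverse unfolding far_def by metis
    show "\<exists>H\<in>F. \<forall>H'\<in>F. hit H H' \<or> far H H'" if F: "F \<subseteq> \<H>" "F \<noteq> {}" for F
    proof -
      \<comment> \<open>\<open>F\<close> may be infinite, but its tops lie in a finite tree, so a
        maximal depth exists.\<close>
      have "finite (depth T r ` top ` F)"
        using F(1) top_verts by (intro finite_imageI finite_subset[OF _ T.finite_verts]) auto
      then have "Max (depth T r ` top ` F) \<in> depth T r ` top ` F"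
        and max: "\<And>H'. H' \<in> F \<Longrightarrow> depth T r (top H') \<le> Max (depth T r ` top ` F)"
        using F(2) by (auto intro: Max_in)
      then obtain H where "H \<in> F" "Max (depth T r ` top ` F) = depth T r (top H)" by auto
      with max F(1) far[of H] show ?thesis by (metis subsetD)
    qed
  qed
  then show ?thesis
  proof (elim disjE exE conjE)
    fix S assume S: "S \<subseteq> \<H>" "finite S" "card S = k" "pairwise far S"
    have "scattered G d S"
      unfolding scattered_def
    proof (intro ballI impI)
      fix H H' assume "H \<in> S" "H' \<in> S" "H \<noteq> H'"
      with S(4) have "far H H'" by (auto simp: pairwise_def)
      then show "(INF (u, u') \<in> verts H \<times> verts H'. gdist G u u') > ereal (real d)"
        by (intro G.INF_gdist_gt) (auto simp: far_def)
    qed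
    with S show ?thesis by blast
  next
    fix S assume S: "S \<subseteq> \<H>" "finite S" "card S < k" "\<forall>H'\<in>\<H>. \<exists>H\<in>S. hit H H'"
    define X where "X = (\<Union>H\<in>S. \<gamma> (top H))"
    have fin: "finite (\<gamma> (top H)) \<and> card (\<gamma> (top H)) \<le> l" if "H \<in> S" for H
      using S(1) that top_verts vigilance by blast
    have "X \<subseteq> verts G"
      using S(1) top_verts guard_subset bag_subset unfolding X_def by blast
    moreover have "finite X"
      using S(2) fin by (auto simp: X_def)
    moreover have "int (card X) \<le> int l * (int k - 1)"
    proof -
      have "card X \<le> (\<Sum>H\<in>S. card (\<gamma> (top H)))"
        unfolding X_def using S(2) by (rule card_UN_le)
      also have "\<dots> \<le> card S * l"
        using sum_bounded_above[of S "\<lambda>H. card (\<gamma> (top H))" l] fin by auto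
      finally have "int (card X) \<le> int l * int (card S)"
        by (simp add: mult.commute flip: of_nat_mult)
      \<comment> \<open>\<open>card S < k\<close> excludes \<open>k = 0\<close>, and over the
        integers it reads \<open>card S\<close> \<le> \<open>k - 1\<close>.\<close>
      also have "\<dots> \<le> int l * (int k - 1)"
        using S(3) by (intro mult_left_mono) auto
      finally show ?thesis .
    qed
    moreover have "verts H' \<inter> graph_ball G d X \<noteq> {}" if H': "H' \<in> \<H>" for H'
    proof -
      obtain H where "H \<in> S" "hit H H'" using S(4) H' by blast
      then show ?thesis by (auto simp: hit_def X_def graph_ball_def)
    qed
    ultimately show ?thesis by blast
  qed
qed

end

theorem theorem9p1:
  fixes G :: "('a,'b) pre_digraph" and \<H> :: "('a,'b) pre_digraph set"
    and T :: "('t,'e) pre_digraph" and r :: 't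
    and \<beta> \<gamma> :: "'t \<Rightarrow> 'a set" and l d k :: nat
  assumes "simple_graph G"
    and "\<H> \<subseteq> connected_subgraphs G"
    and "guarded_tree_decomposition G T r \<beta> \<gamma>"
    and "has_vigilance T \<gamma> l"
    and "distance_guards G T \<beta> \<gamma> d \<H>"
  shows "(\<exists>\<H>'\<subseteq>\<H>. finite \<H>' \<and> card \<H>' = k \<and> scattered G d \<H>') \<or>
    (\<exists>X\<subseteq>verts G. finite X \<and> int (card X) \<le> int l * (int k - 1) \<and>
      (\<forall>H\<in>\<H>. verts H \<inter> graph_ball G d X \<noteq> {}))"
proof -
  have "graph T"
    using assms(3)
    by (simp add: guarded_tree_decomposition_def rooted_tree_decomposition_def rooted_tree_def)
  then interpret guarded_decomposition G T r \<beta> \<gamma>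
    using assms(1,3) by (intro guarded_decomposition.intro guarded_decomposition_axioms.intro)
  have "finite (\<gamma> t) \<and> card (\<gamma> t) \<le> l" if "t \<in> verts T" for t
    using assms(4) that by (auto simp: has_vigilance_def)
  with assms(2,5) show ?thesis by (rule packing_or_covering)
qed

end
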